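(* Let $q=p^r$, where $p$ is an odd prime and $r\ge1$, and let $N_q$ be the number of triples $\gamma-1,\gamma,\gamma+1$ of consecutive non-square elements of $\mathbb{F}_q$. (1) If $q\equiv 7\pmod 8$, then $N_q=\dfrac{q-7}{8}$. (2) If $q\equiv 3\pmod 8$, then $N_q=\dfrac{q-3}{8}$. (3) If $q\equiv 5\pmod 8$, then $N_q=\dfrac{q-2s-3}{8}$, where $s$ is the integer uniquely determined by $q=s^2+t^2$ with $t\in\mathbb{Z}$, $p\nmid s$, $s\equiv 1\pmod 4$. (4) If $q\equiv 1\pmod 8$ and $p\equiv 1\pmod 4$, then $N_q=\dfrac{q+2s-3}{8}$, where $s$ is the integer uniquely determined by $q=s^2+t^2$ with $t\in\mathbb{Z}$, $p\nmid s$, $s\equiv 1\pmod 4$. (5) If $q\equiv 1\pmod 8$ and $p\equiv 3\pmod 4$, then $q$ is a square and $N_q=\dfrac18\bigl(q+2(-1)^{r/2}\sqrt{q}-3\bigr)$.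
   Context: $\mathbb{F}_q$ is the finite field with $q$ elements. An element of $\mathbb{F}_q$ is a square if it equals $\beta^2$ for some $\beta\in\mathbb{F}_q$ (so $0$ is a square), and a non-square otherwise. $N_q$ counts the elements $\gamma\in\mathbb{F}_q$ such that all three of $\gamma-1,\gamma,\gamma+1$ are non-squares. *)

theory Defs
  imports
    Complex_Main
    "HOL-Library.Cardinality"
    "HOL-Computational_Algebra.Nth_Powers"
    "HOL-Number_Theory.Number_Theory"
begin

text \<open>
  The finite field with \<open>q\<close> elements is a type \<open>'a :: {field, finite}\<close> with \<open>CARD('a) = q\<close>;
  \<^const>\<open>is_nth_power\<close> at exponent \<open>2\<close> (\<open>is_square\<close>) counts \<open>0\<close> as a square.
\<close>

definition num_nonsquare_triples :: "'a :: {field, finite} itself \<Rightarrow> nat" where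
  "num_nonsquare_triples _ =
     card {\<gamma> :: 'a. \<not> is_square (\<gamma> - 1) \<and> \<not> is_square \<gamma> \<and> \<not> is_square (\<gamma> + 1)}"

definition normalized_square_part :: "nat \<Rightarrow> nat \<Rightarrow> int \<Rightarrow> bool" where
  "normalized_square_part p q s \<longleftrightarrow>
     (\<exists>t :: int. int q = s\<^sup>2 + t\<^sup>2) \<and> \<not> int p dvd s \<and> [s = 1] (mod 4)"

end

theory Submission
  imports Defs "HOL-Computational_Algebra.Polynomial"
begin

text \<open>
  Write \<open>\<chi>\<close> for the quadratic character \<open>qchar\<close>. Away from \<open>\<gamma> = -1\<close> the product
  \<open>(1 - \<chi>(\<gamma> - 1)) (1 - \<chi>(\<gamma>)) (1 - \<chi>(\<gamma> + 1))\<close> is \<open>8\<close> if \<open>\<gamma>\<close> is counted by \<open>N\<close> and \<open>0\<close>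
  otherwise. Expanding it and summing, the linear terms cancel, each of the three quadratic terms gives
  \<open>-1\<close>, and there remains
  \<open>8 N = q - 3 - S - (1 - \<chi>(-2)) (1 - \<chi>(-1))\<close> with \<open>S = \<Sum>x. \<chi>(x\<^sup>3 - x)\<close>, the character sum of
  the elliptic curve \<open>y\<^sup>2 = x\<^sup>3 - x\<close> (\<open>num_nonsquare_triples_char_sum\<close>). Since \<open>N\<close> is an integer,
  this identity also holds information modulo \<open>8\<close>, and it settles every sign below.

  If \<open>q \<equiv> 3 (mod 4)\<close>, then \<open>\<chi>(-1) = -1\<close>, and the substitution \<open>x \<mapsto> -x\<close> shows \<open>S = 0\<close>. The
  value of \<open>\<chi>(-2)\<close> is forced by integrality modulo \<open>8\<close>, without the supplementary laws of quadratic
  reciprocity.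

  If \<open>q \<equiv> 1 (mod 4)\<close>, then \<open>\<chi>(-1) = 1\<close> and \<open>S = q - 3 - 8 N\<close> is even, say \<open>S = 2 A\<close>, with \<open>A\<close>
  known modulo \<open>4\<close>. Jacobsthal's argument evaluates the second moment of the twisted sums
  \<open>\<Sum>x. \<chi>(x\<^sup>3 - a x)\<close> over all \<open>a\<close>; as these take only two values up to sign on \<open>a \<noteq> 0\<close>, it gives
  \<open>q = A\<^sup>2 + B\<^sup>2\<close> (\<open>sum_two_squares_cubic_sums\<close>). Two cases remain.
    \<^item> For \<open>p \<equiv> 1 (mod 4)\<close>, Euler's criterion turns \<open>S\<close> modulo \<open>p\<close> into a sum of powers in the field,
      and only one binomial coefficient \<open>(q - 1)/2\<close> over \<open>(q - 1)/4\<close> survives. All base \<open>p\<close> digits of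
      the lower entry are half of those of the upper one, so \<open>p\<close> does not divide it
      (\<open>not_dvd_cubic_sum\<close>). Hence \<open>A\<close> is, up to sign, the unique part \<open>s\<close>.
    \<^item> For \<open>p \<equiv> 3 (mod 4)\<close>, descent on the exponent shows that a representation of \<open>p ^ r\<close> with
      \<open>A\<close> odd has \<open>\<bar>A\<bar> = p ^ (r/2)\<close> (\<open>sum_squares_prime_power_3_mod_4\<close>).
\<close>

section \<open>The quadratic character of a finite field of odd order\<close>

definition qchar :: "'a :: {field, finite} \<Rightarrow> int" where
  "qchar x = (if x = 0 then 0 else if is_square x then 1 else -1)"

definition cubic_sum :: "'a :: {field, finite} \<Rightarrow> int" where
  "cubic_sum a = (\<Sum>x\<in>UNIV. qchar (x ^ 3 - a * x))"

lemma qchar_0 [simp]: "qchar 0 = 0"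
  and qchar_1 [simp]: "qchar 1 = 1"
  and qchar_eq_0_iff [simp]: "qchar x = 0 \<longleftrightarrow> x = 0"
  by (auto simp: qchar_def)

lemma qchar_cases: "qchar x \<in> {-1, 0, 1}"
  by (auto simp: qchar_def)

lemma qchar_square: "x \<noteq> 0 \<Longrightarrow> (qchar x)\<^sup>2 = 1"
  by (auto simp: qchar_def)

text \<open>
  Multiplication by \<open>x\<close> permutes the nonzero elements, so it does not change their product.
\<close>

lemma power_card_minus_1_field:
  fixes x :: "'a :: {field, finite}"
  assumes "x \<noteq> 0"
  shows "x ^ (CARD('a) - 1) = 1"
proof -
  have "(\<Prod>y\<in>UNIV-{0}. x * y) = x ^ (CARD('a) - 1) * \<Prod>(UNIV-{0})"
    by (simp add: prod.distrib card_Diff_singleton)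
  also have "(\<Prod>y\<in>UNIV-{0}. x * y) = \<Prod>(UNIV-{0})"
    by (rule prod.reindex_bij_witness[of _ "\<lambda>y. y / x" "\<lambda>y. x * y"]) (use assms in auto)
  finally show ?thesis
    by simp
qed

lemma card_power_eq_1_le:
  assumes "n > 0"
  shows "card {x :: 'a :: {field, finite}. x ^ n = 1} \<le> n"
proof -
  have "card {x :: 'a. poly (Polynomial.monom 1 n - 1) x = 0} \<le> degree (Polynomial.monom (1 :: 'a) n - 1)"
  proof (rule card_poly_roots_bound)
    have "poly.coeff (Polynomial.monom (1 :: 'a) n - 1) n = 1"
      using assms by simp
    then show "Polynomial.monom (1 :: 'a) n - 1 \<noteq> 0"
      by (metis coeff_0 zero_neq_one)
  qed
  also have "degree (Polynomial.monom (1 :: 'a) n - 1) \<le> n"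
    by (intro degree_diff_le) (auto simp: Polynomial.degree_monom_le)
  finally show ?thesis
    by (simp add: poly_monom)
qed

text \<open>
  Multiplying the summation variable by some \<open>g\<close> multiplies the sum by \<open>g ^ k\<close>. A suitable \<open>g\<close> with
  \<open>g ^ k \<noteq> 1\<close> exists because the polynomial \<open>X ^ (k mod (q - 1)) - 1\<close> has too few roots.
\<close>

lemma sum_power_eq_0:
  assumes "\<not> (CARD('a :: {field, finite}) - 1) dvd k"
  shows "(\<Sum>x\<in>(UNIV :: 'a set). x ^ k) = 0"
proof -
  define n where "n = CARD('a) - 1"
  have card: "card (UNIV - {0 :: 'a}) = n"
    by (simp add: n_def card_Diff_singleton)
  have "n > 0"
    using finite_UNIV_card_ge_0[where ?'a = 'a] card_mono[of UNIV "{0, 1 :: 'a}"] unfolding n_def by simp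
  have k: "0 < k mod n" "k mod n < n"
    using assms \<open>n > 0\<close> by (auto simp: n_def dvd_eq_mod_eq_0)
  have red: "x ^ k = x ^ (k mod n)" if "x \<noteq> 0" for x :: 'a
  proof -
    have "x ^ k = x ^ (n * (k div n) + k mod n)"
      by simp
    also have "\<dots> = x ^ (k mod n)"
      unfolding power_add power_mult using power_card_minus_1_field[OF that] by (simp add: n_def)
    finally show ?thesis .
  qed
  obtain g :: 'a where g: "g \<noteq> 0" "g ^ k \<noteq> 1"
  proof (rule ccontr)
    assume "\<not> thesis"
    then have "UNIV - {0 :: 'a} \<subseteq> {x. x ^ (k mod n) = 1}"
      using that red by force
    then have "n \<le> card {x :: 'a. x ^ (k mod n) = 1}"
      unfolding card[symmetric] by (intro card_mono) auto
    also have "\<dots> \<le> k mod n"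
      by (rule card_power_eq_1_le) fact
    finally show False
      using k by simp
  qed
  have "(\<Sum>x\<in>(UNIV :: 'a set). x ^ k) = (\<Sum>x\<in>UNIV. (g * x) ^ k)"
    by (rule sum.reindex_bij_witness[of _ "\<lambda>x. g * x" "\<lambda>x. x / g"]) (use g in auto)
  also have "\<dots> = g ^ k * (\<Sum>x\<in>UNIV. x ^ k)"
    by (simp add: power_mult_distrib sum_distrib_left)
  finally have "(1 - g ^ k) * (\<Sum>x\<in>(UNIV :: 'a set). x ^ k) = 0"
    by (simp add: algebra_simps)
  with g show ?thesis
    by simp
qed

context
  fixes F :: "'a :: {field, finite} itself"
  assumes odd_card: "odd CARD('a)"
begin

lemma two_neq_0: "(2 :: 'a) \<noteq> 0"
proof
  assume "(2 :: 'a) = 0"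
  then have "CHAR('a) dvd 2"
    by (metis of_nat_eq_0_iff_char_dvd of_nat_numeral)
  moreover have "CHAR('a) dvd CARD('a)"
    by (rule CHAR_dvd_CARD)
  ultimately have "CHAR('a) dvd 1"
    by (metis odd_card coprime_common_divisor coprime_left_2_iff_odd)
  then show False
    using CHAR_not_1' by simp
qed

lemma card_field_ge_3: "CARD('a) \<ge> 3"
proof -
  have "card {0, 1 :: 'a} \<le> CARD('a)"
    by (intro card_mono) auto
  then show ?thesis
    using odd_card by (cases "CARD('a) = 2") auto
qed

lemma neg_eq_iff: "x = - x \<longleftrightarrow> x = (0 :: 'a)"
  using two_neq_0 by (metis add.inverse_neutral eq_neg_iff_add_eq_0 mult_2 mult_eq_0_iff)

text \<open>
  Euler's criterion, by counting: squaring is two-to-one on nonzero elements, so there are \<open>(q - 1)/2\<close>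
  nonzero squares. All of them are roots of \<open>X ^ ((q - 1)/2) - 1\<close>, which has no room for further roots.
\<close>

lemma square_iff_power_half:
  fixes x :: 'a
  assumes "x \<noteq> 0"
  shows "is_square x \<longleftrightarrow> x ^ ((CARD('a) - 1) div 2) = 1"
proof -
  define m where "m = (CARD('a) - 1) div 2"
  have m: "CARD('a) - 1 = 2 * m"
    using odd_card by (auto simp: m_def)
  have "m > 0"
    using m card_field_ge_3 by simp
  define Q where "Q = {x :: 'a. x \<noteq> 0 \<and> is_square x}"
  have fibre: "card {y. y \<noteq> 0 \<and> y\<^sup>2 = x} = 2" if "x \<in> Q" for x :: 'a
  proof -
    from that obtain y where y: "x = y\<^sup>2" "y \<noteq> 0"
      by (auto simp: Q_def is_nth_power_def)
    have "{z. z \<noteq> 0 \<and> z\<^sup>2 = x} = {y, -y}"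
      using y by (auto simp: power2_eq_iff)
    then show ?thesis
      using y neg_eq_iff[of y] by simp
  qed
  have "2 * m = card (UNIV - {0 :: 'a})"
    by (simp only: card_Diff_singleton UNIV_I m)
  also have "UNIV - {0 :: 'a} = (\<Union>x\<in>Q. {y. y \<noteq> 0 \<and> y\<^sup>2 = x})"
    by (auto simp: Q_def)
  also have "card \<dots> = (\<Sum>x\<in>Q. card {y. y \<noteq> 0 \<and> y\<^sup>2 = x})"
    by (rule card_UN_disjoint) auto
  also have "\<dots> = 2 * card Q"
    using fibre by simp
  finally have "card Q = m"
    by simp
  moreover have "Q \<subseteq> {x. x ^ m = 1}"
  proof
    fix x assume "x \<in> Q"
    then obtain y where y: "x = y\<^sup>2" "y \<noteq> 0"
      by (auto simp: Q_def is_nth_power_def)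
    then show "x \<in> {x. x ^ m = 1}"
      using power_card_minus_1_field[of y] unfolding m by (simp add: power_mult)
  qed
  ultimately have "Q = {x. x ^ m = 1}"
    using card_power_eq_1_le[OF \<open>m > 0\<close>, where ?'a = 'a] by (intro card_seteq) auto
  then show ?thesis
    using assms unfolding m_def[symmetric] by (auto simp: Q_def)
qed

lemma of_int_qchar: "of_int (qchar x) = (x :: 'a) ^ ((CARD('a) - 1) div 2)"
proof (cases "x = 0")
  case True
  then show ?thesis
    using card_field_ge_3 by (simp add: qchar_def power_0_left)
next
  case False
  have "(x ^ ((CARD('a) - 1) div 2))\<^sup>2 = 1"
    using power_card_minus_1_field[OF False] odd_card by (simp flip: power_mult)
  then have "x ^ ((CARD('a) - 1) div 2) \<in> {1, -1}"
    by (simp add: power2_eq_1_iff)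
  then show ?thesis
    using False square_iff_power_half[OF False] by (auto simp: qchar_def)
qed

text \<open>
  In odd characteristic \<open>-1\<close>, \<open>0\<close>, \<open>1\<close> remain distinct in the field. So identities between
  character values may be checked after mapping them there, where the character is a power function.
\<close>

lemma qchar_eqI:
  fixes x :: 'a
  assumes "of_int (qchar x) = (of_int c :: 'a)" "c \<in> {-1, 0, 1}"
  shows "qchar x = c"
  using assms qchar_cases[of x] neg_eq_iff[of 1] neg_eq_iff[of "-1"] by auto

lemma qchar_mult: "qchar (x * y) = qchar x * qchar (y :: 'a)"
proof (rule qchar_eqI)
  show "of_int (qchar (x * y)) = (of_int (qchar x * qchar y) :: 'a)"
    by (simp add: of_int_qchar power_mult_distrib)
  show "qchar x * qchar y \<in> {-1, 0, 1}"
    using qchar_cases[of x] qchar_cases[of y] by auto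
qed

lemma qchar_power: "qchar (x ^ k) = qchar (x :: 'a) ^ k"
  by (induction k) (simp_all add: qchar_mult)

lemma qchar_minus_1: "qchar (-1 :: 'a) = (-1) ^ ((CARD('a) - 1) div 2)"
proof (rule qchar_eqI)
  show "of_int (qchar (-1 :: 'a)) = (of_int ((-1) ^ ((CARD('a) - 1) div 2)) :: 'a)"
    by (simp add: of_int_qchar)
  show "(-1) ^ ((CARD('a) - 1) div 2) \<in> {-1, 0, 1 :: int}"
    by (auto simp: minus_one_power_iff)
qed

lemma ex_nonsquare: "\<exists>n :: 'a. qchar n = -1"
proof (rule ccontr)
  assume "\<not> ?thesis"
  then have "qchar x = 1" if "x \<noteq> 0" for x :: 'a
    using that qchar_cases[of x] by auto
  then have "UNIV - {0 :: 'a} \<subseteq> {x. x ^ ((CARD('a) - 1) div 2) = 1}"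
    unfolding of_int_qchar[symmetric] by auto
  then have "card (UNIV - {0 :: 'a}) \<le> card {x :: 'a. x ^ ((CARD('a) - 1) div 2) = 1}"
    by (intro card_mono) auto
  also have "\<dots> \<le> (CARD('a) - 1) div 2"
    using card_field_ge_3 by (intro card_power_eq_1_le) auto
  finally show False
    using card_field_ge_3 by (simp add: card_Diff_singleton)
qed

section \<open>Character sums\<close>

lemma sum_qchar: "(\<Sum>x\<in>UNIV. qchar (x :: 'a)) = 0"
proof -
  obtain n :: 'a where n: "qchar n = -1"
    using ex_nonsquare by blast
  then have "n \<noteq> 0"
    by auto
  then have "(\<Sum>x\<in>UNIV. qchar (x :: 'a)) = (\<Sum>x\<in>UNIV. qchar (n * x))"
    by (intro sum.reindex_bij_witness[of _ "\<lambda>x. n * x" "\<lambda>x. x / n"]) auto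
  also have "\<dots> = - (\<Sum>x\<in>UNIV. qchar (x :: 'a))"
    by (simp add: qchar_mult n sum_negf)
  finally show ?thesis
    by simp
qed

lemma sum_qchar_shift: "(\<Sum>x\<in>UNIV. qchar (x + c :: 'a)) = 0"
proof -
  have "(\<Sum>x\<in>UNIV. qchar (x + c :: 'a)) = (\<Sum>x\<in>UNIV. qchar (x :: 'a))"
    by (rule sum.reindex_bij_witness[of _ "\<lambda>x. x - c" "\<lambda>x. x + c"]) auto
  then show ?thesis
    by (simp add: sum_qchar)
qed

text \<open>
  After translation the summand is \<open>\<chi>(x (x + c)) = \<chi>(x\<^sup>2 (1 + c/x)) = \<chi>(1 + c/x)\<close>, and for
  \<open>x \<noteq> 0\<close> the argument runs through everything except \<open>1\<close>.
\<close>

lemma sum_qchar_quadratic: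
  fixes a b :: 'a
  assumes "a \<noteq> b"
  shows "(\<Sum>x\<in>UNIV. qchar ((x - a) * (x - b))) = -1"
proof -
  define c where "c = a - b"
  have "c \<noteq> 0"
    using assms by (simp add: c_def)
  have "(\<Sum>x\<in>UNIV. qchar ((x - a) * (x - b))) = (\<Sum>x\<in>UNIV. qchar (x * (x + c)))"
    by (rule sum.reindex_bij_witness[of _ "\<lambda>x. x + a" "\<lambda>x. x - a"]) (auto simp: c_def)
  also have "\<dots> = (\<Sum>x\<in>UNIV-{0}. qchar (x * (x + c)))"
    by (rule sum.mono_neutral_right) auto
  also have "\<dots> = (\<Sum>x\<in>UNIV-{1 :: 'a}. qchar x)"
  proof (rule sum.reindex_bij_witness[of _ "\<lambda>y. c / (y - 1)" "\<lambda>x. 1 + c / x"])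
    fix x :: 'a assume "x \<in> UNIV - {0}"
    then have "x * (x + c) = x\<^sup>2 * (1 + c / x)"
      by (simp add: field_simps power2_eq_square)
    then show "qchar (1 + c / x) = qchar (x * (x + c))"
      using \<open>x \<in> UNIV - {0}\<close> by (simp add: qchar_mult qchar_power qchar_square)
  qed (use \<open>c \<noteq> 0\<close> in auto)
  also have "\<dots> = -1"
    using sum.remove[of UNIV "1 :: 'a" qchar] by (simp add: sum_qchar)
  finally show ?thesis .
qed

lemma sum_qchar_squares: "(\<Sum>x\<in>UNIV. qchar ((x - a) * (x - a :: 'a))) = int CARD('a) - 1"
proof -
  have "(\<Sum>x\<in>UNIV. qchar ((x - a) * (x - a))) = (\<Sum>x\<in>UNIV-{a}. qchar ((x - a) * (x - a)))"
    by (rule sum.mono_neutral_right) auto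
  also have "\<dots> = (\<Sum>x\<in>UNIV-{a}. 1)"
    by (rule sum.cong) (auto simp: qchar_power qchar_square simp flip: power2_eq_square)
  also have "\<dots> = int CARD('a) - 1"
    using card_field_ge_3 by (simp add: card_Diff_singleton of_nat_diff)
  finally show ?thesis .
qed

text \<open>
  The summand \<open>f\<close> detects triples even at \<open>\<gamma> = 0\<close> and \<open>\<gamma> = 1\<close>, because there the factor containing
  \<open>\<chi>(1)\<close> vanishes. The product on the right is the excess at \<open>\<gamma> = -1\<close>.
\<close>

lemma num_nonsquare_triples_char_sum:
  "8 * int (num_nonsquare_triples TYPE('a)) =
     int CARD('a) - 3 - cubic_sum (1 :: 'a) - (1 - qchar (-2 :: 'a)) * (1 - qchar (-1 :: 'a))"
proof -
  define f where "f x = (1 - qchar (x - 1)) * (1 - qchar x) * (1 - qchar (x + 1))" for x :: 'a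
  define T where "T = {x :: 'a. \<not> is_square (x - 1) \<and> \<not> is_square x \<and> \<not> is_square (x + 1)}"
  have f_indicator: "f x = 8 * of_bool (x \<in> T)" if "x \<noteq> -1" for x
    using that by (auto simp: f_def T_def qchar_def eq_neg_iff_add_eq_0)
  have "(\<Sum>x\<in>UNIV. f x) = f (-1) + (\<Sum>x\<in>UNIV-{-1}. f x)"
    by (rule sum.remove) auto
  also have "(\<Sum>x\<in>UNIV-{-1}. f x) = (\<Sum>x\<in>UNIV-{-1}. 8 * of_bool (x \<in> T))"
    by (rule sum.cong) (auto simp: f_indicator)
  also have "\<dots> = (\<Sum>x\<in>T. 8)"
    by (rule sum.mono_neutral_cong_right) (auto simp: T_def)
  also have "\<dots> = 8 * int (num_nonsquare_triples TYPE('a))"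
    by (simp add: T_def num_nonsquare_triples_def)
  also have "f (-1) = (1 - qchar (-2 :: 'a)) * (1 - qchar (-1 :: 'a))"
    by (simp add: f_def)
  finally have 1: "(\<Sum>x\<in>UNIV. f x) = (1 - qchar (-2 :: 'a)) * (1 - qchar (-1 :: 'a))
      + 8 * int (num_nonsquare_triples TYPE('a))" .
  have "f x = 1 - qchar (x + (-1)) - qchar (x + 0) - qchar (x + 1)
      + qchar ((x - 1) * (x - 0)) + qchar ((x - 0) * (x - (-1))) + qchar ((x - 1) * (x - (-1)))
      - qchar (x ^ 3 - 1 * x)" for x
  proof -
    have "x ^ 3 - 1 * x = (x - 1) * x * (x + 1)"
      by (simp add: algebra_simps power3_eq_cube)
    then show ?thesis
      unfolding f_def by (simp only: qchar_mult) (simp add: algebra_simps)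
  qed
  then have "(\<Sum>x\<in>UNIV. f x) = (\<Sum>x\<in>(UNIV :: 'a set). 1 - qchar (x + (-1)) - qchar (x + 0) - qchar (x + 1)
      + qchar ((x - 1) * (x - 0)) + qchar ((x - 0) * (x - (-1))) + qchar ((x - 1) * (x - (-1)))
      - qchar (x ^ 3 - 1 * x))"
    by simp
  also have "\<dots> = int CARD('a) - 3 - cubic_sum (1 :: 'a)"
    unfolding sum.distrib sum_subtractf sum_qchar_shift cubic_sum_def
    using neg_eq_iff[of 1] by (subst (1 2 3) sum_qchar_quadratic) auto
  finally show ?thesis
    using 1 by simp
qed

text \<open>
  Substituting \<open>b x\<close> for \<open>x\<close> in the cubic takes out the factor \<open>b\<^sup>3\<close>.
\<close>

lemma cubic_sum_scale:
  fixes a b :: 'a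
  assumes "b \<noteq> 0"
  shows "cubic_sum (a * b\<^sup>2) = qchar b * cubic_sum a"
proof -
  have "cubic_sum (a * b\<^sup>2) = (\<Sum>x\<in>UNIV. qchar ((b * x) ^ 3 - a * b\<^sup>2 * (b * x)))"
    unfolding cubic_sum_def
    by (rule sum.reindex_bij_witness[of _ "\<lambda>x. b * x" "\<lambda>x. x / b"]) (use assms in auto)
  also have "\<dots> = (\<Sum>x\<in>UNIV. qchar b * qchar (x ^ 3 - a * x))"
  proof (rule sum.cong)
    fix x :: 'a
    have "(b * x) ^ 3 - a * b\<^sup>2 * (b * x) = b\<^sup>2 * (b * (x ^ 3 - a * x))"
      by (simp add: algebra_simps power3_eq_cube power2_eq_square)
    then show "qchar ((b * x) ^ 3 - a * b\<^sup>2 * (b * x)) = qchar b * qchar (x ^ 3 - a * x)"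
      by (simp add: qchar_mult qchar_power qchar_square assms)
  qed auto
  finally show ?thesis
    by (simp add: cubic_sum_def sum_distrib_left)
qed

lemma cubic_sum_eq_0:
  assumes "qchar (-1 :: 'a) = -1"
  shows "cubic_sum (a :: 'a) = 0"
  using cubic_sum_scale[of "-1" a] assms by simp

lemma cubic_sum_squared_cong:
  fixes a b :: 'a
  assumes "a \<noteq> 0" "b \<noteq> 0" "qchar a = qchar b"
  shows "(cubic_sum a)\<^sup>2 = (cubic_sum b)\<^sup>2"
proof -
  have "qchar (b / a) * qchar a = qchar b"
    using assms(1) unfolding qchar_mult[symmetric] by simp
  then have "qchar (b / a) = 1"
    using assms by auto
  then obtain c where c: "b / a = c\<^sup>2"
    by (auto simp: qchar_def is_nth_power_def split: if_splits)
  then have "b = a * c\<^sup>2" "c \<noteq> 0"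
    using assms by (auto simp: field_simps)
  then show ?thesis
    by (simp add: cubic_sum_scale power_mult_distrib qchar_square)
qed

lemma sum_qchar_pair:
  fixes x y :: 'a
  shows "(\<Sum>a\<in>UNIV. qchar ((x\<^sup>2 - a) * (y\<^sup>2 - a))) = int CARD('a) * of_bool (x\<^sup>2 = y\<^sup>2) - 1"
proof -
  have "(x\<^sup>2 - a) * (y\<^sup>2 - a) = (a - x\<^sup>2) * (a - y\<^sup>2)" for a
    by (simp add: algebra_simps)
  then show ?thesis
    using sum_qchar_quadratic[of "x\<^sup>2" "y\<^sup>2"] sum_qchar_squares[of "y\<^sup>2"]
    by (cases "x\<^sup>2 = y\<^sup>2") auto
qed

text \<open>
  Expanding the square and summing over \<open>a\<close> first leaves a quadratic character sum for every pair
  \<open>(x, y)\<close>; this is \<open>-1\<close> unless \<open>y = x\<close> or \<open>y = -x\<close>. The constant \<open>-1\<close> contributes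
  nothing, since \<open>\<Sum>x. \<Sum>y. \<chi>(x y) = 0\<close>.
\<close>

lemma sum_cubic_sum_squared:
  assumes "qchar (-1 :: 'a) = 1"
  shows "(\<Sum>a\<in>(UNIV :: 'a set). (cubic_sum a)\<^sup>2) = 2 * int CARD('a) * (int CARD('a) - 1)"
proof -
  have "(\<Sum>a\<in>(UNIV :: 'a set). (cubic_sum a)\<^sup>2) =
      (\<Sum>a\<in>(UNIV :: 'a set). \<Sum>x\<in>UNIV. \<Sum>y\<in>UNIV. qchar (x * y) * qchar ((x\<^sup>2 - a) * (y\<^sup>2 - a)))"
  proof (rule sum.cong)
    fix a :: 'a
    have "x ^ 3 - a * x = x * (x\<^sup>2 - a)" for x
      by (simp add: algebra_simps power3_eq_cube power2_eq_square)
    then show "(cubic_sum a)\<^sup>2 = 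
        (\<Sum>x\<in>UNIV. \<Sum>y\<in>UNIV. qchar (x * y) * qchar ((x\<^sup>2 - a) * (y\<^sup>2 - a)))"
      by (simp add: cubic_sum_def power2_eq_square[of "sum _ _"] sum_product qchar_mult mult_ac)
  qed auto
  also have "\<dots> = (\<Sum>x\<in>UNIV. \<Sum>y\<in>UNIV. \<Sum>a\<in>(UNIV :: 'a set). 
      qchar (x * y) * qchar ((x\<^sup>2 - a) * (y\<^sup>2 - a)))"
    by (subst sum.swap, intro sum.cong refl sum.swap)
  also have "\<dots> = (\<Sum>x\<in>UNIV. \<Sum>y\<in>(UNIV :: 'a set). 
      int CARD('a) * (qchar (x * y) * of_bool (x\<^sup>2 = y\<^sup>2)) - qchar x * qchar y)"
    by (intro sum.cong refl, subst sum_distrib_left [symmetric], subst sum_qchar_pair)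
      (simp add: algebra_simps qchar_mult)
  also have "\<dots> = int CARD('a) * (\<Sum>x\<in>UNIV. \<Sum>y\<in>(UNIV :: 'a set). qchar (x * y) * of_bool (x\<^sup>2 = y\<^sup>2))"
    by (simp add: sum_subtractf sum_qchar flip: sum_distrib_left)
  also have "(\<Sum>x\<in>UNIV. \<Sum>y\<in>(UNIV :: 'a set). qchar (x * y) * of_bool (x\<^sup>2 = y\<^sup>2)) =
      (\<Sum>x\<in>(UNIV :: 'a set). 2 * of_bool (x \<noteq> 0))"
  proof (rule sum.cong)
    fix x :: 'a
    have "(\<Sum>y\<in>(UNIV :: 'a set). qchar (x * y) * of_bool (x\<^sup>2 = y\<^sup>2)) = (\<Sum>y\<in>{x, -x}. qchar (x * y))"
      by (rule sum.mono_neutral_cong_right) (auto simp: power2_eq_iff)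
    also have "\<dots> = 2 * of_bool (x \<noteq> 0)"
    proof (cases "x = 0")
      case False
      have "qchar (x * - x) = qchar (x\<^sup>2 * (-1))"
        by (simp add: power2_eq_square)
      also have "\<dots> = 1"
        by (simp only: qchar_mult qchar_power qchar_square[OF False] assms)
      finally have "qchar (x * - x) = 1" .
      moreover have "qchar (x * x) = 1"
        using False by (simp add: qchar_power qchar_square flip: power2_eq_square)
      moreover have "x \<noteq> - x"
        using False neg_eq_iff by blast
      ultimately show ?thesis
        using False by (simp del: mult_minus_right)
    qed auto
    finally show "(\<Sum>y\<in>(UNIV :: 'a set). qchar (x * y) * of_bool (x\<^sup>2 = y\<^sup>2)) = 2 * of_bool (x \<noteq> 0)" .
  qed auto
  also have "\<dots> = (\<Sum>x\<in>UNIV-{0 :: 'a}. 2)"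
    by (rule sum.mono_neutral_cong_right) auto
  also have "\<dots> = 2 * (int CARD('a) - 1)"
    using card_field_ge_3 by (simp add: card_Diff_singleton of_nat_diff)
  finally show ?thesis
    by simp
qed

text \<open>
  By \<open>cubic_sum_squared_cong\<close> each of the two squares occurs for half of the \<open>q - 1\<close> nonzero \<open>a\<close> in
  the second moment \<open>2 q (q - 1)\<close>.
\<close>

lemma sum_two_squares_cubic_sums:
  fixes n :: 'a
  assumes minus_1: "qchar (-1 :: 'a) = 1" and n: "qchar n = -1"
  shows "(cubic_sum (1 :: 'a))\<^sup>2 + (cubic_sum n)\<^sup>2 = 4 * int CARD('a)"
proof -
  define u v where "u = (cubic_sum (1 :: 'a))\<^sup>2" and "v = (cubic_sum n)\<^sup>2"
  have "cubic_sum (0 :: 'a) = 0"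
  proof -
    have "cubic_sum (0 :: 'a) = (\<Sum>x\<in>UNIV. qchar (x :: 'a))"
      unfolding cubic_sum_def
    proof (rule sum.cong)
      fix x :: 'a
      show "qchar (x ^ 3 - 0 * x) = qchar x"
        using qchar_cases[of x] by (auto simp: qchar_power)
    qed auto
    then show ?thesis
      by (simp add: sum_qchar)
  qed
  have val: "2 * (cubic_sum x)\<^sup>2 = (1 + qchar x) * u + (1 - qchar x) * v" if "x \<noteq> 0" for x :: 'a
  proof -
    have "n \<noteq> 0"
      using n by auto
    then show ?thesis
      using qchar_cases[of x] cubic_sum_squared_cong[of x 1] cubic_sum_squared_cong[of x n] that n
      by (auto simp: u_def v_def)
  qed
  have "4 * int CARD('a) * (int CARD('a) - 1) = (\<Sum>x\<in>(UNIV :: 'a set). 2 * (cubic_sum x)\<^sup>2)"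
    by (simp add: sum_cubic_sum_squared[OF minus_1] flip: sum_distrib_left)
  also have "\<dots> = (\<Sum>x\<in>UNIV-{0 :: 'a}. 2 * (cubic_sum x)\<^sup>2)"
    by (rule sum.mono_neutral_right) (auto simp: \<open>cubic_sum 0 = 0\<close>)
  also have "\<dots> = (\<Sum>x\<in>UNIV-{0 :: 'a}. (u + v) + qchar x * (u - v))"
    by (rule sum.cong) (auto simp: val algebra_simps)
  also have "\<dots> = (int CARD('a) - 1) * (u + v) + (\<Sum>x\<in>UNIV-{0 :: 'a}. qchar x) * (u - v)"
    using card_field_ge_3
    by (simp add: sum.distrib card_Diff_singleton of_nat_diff sum_distrib_right)
  also have "(\<Sum>x\<in>UNIV-{0 :: 'a}. qchar x) = 0"
    using sum.remove[of UNIV "0 :: 'a" qchar] by (simp add: sum_qchar)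
  finally have "(int CARD('a) - 1) * (u + v) = (int CARD('a) - 1) * (4 * int CARD('a))"
    by (simp only: mult_zero_left add_0_right mult.commute)
  moreover have "int CARD('a) - 1 \<noteq> 0"
    using card_field_ge_3 by simp
  ultimately have "u + v = 4 * int CARD('a)"
    by (metis mult_left_cancel)
  then show ?thesis
    by (simp add: u_def v_def)
qed

text \<open>
  With \<open>q - 1 = 4 k\<close>, expand \<open>(x\<^sup>3 - x) ^ (2 k)\<close>. The exponents \<open>2 j + 2 k\<close> lie between
  \<open>2 k\<close> and \<open>6 k\<close>, and \<open>4 k\<close> is the only multiple of \<open>q - 1\<close> among them.
\<close>

lemma of_int_cubic_sum:
  assumes "4 dvd CARD('a) - 1"
  shows "(of_int (cubic_sum (1 :: 'a)) :: 'a) =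
    - ((-1) ^ ((CARD('a) - 1) div 4) * of_nat (((CARD('a) - 1) div 2) choose ((CARD('a) - 1) div 4)))"
proof -
  define k where "k = (CARD('a) - 1) div 4"
  have card: "CARD('a) - 1 = 4 * k"
    using assms by (simp add: k_def)
  have "k > 0"
    using card card_field_ge_3 by simp
  have power_sum: "(\<Sum>x\<in>(UNIV :: 'a set). x ^ (2 * j + 2 * k)) = - of_bool (j = k)" if "j \<le> 2 * k" for j
  proof (cases "j = k")
    case True
    have "(\<Sum>x\<in>(UNIV :: 'a set). x ^ (2 * j + 2 * k)) = (\<Sum>x\<in>UNIV-{0 :: 'a}. x ^ (4 * k))"
      using True \<open>k > 0\<close> by (intro sum.mono_neutral_cong_right) auto
    also have "\<dots> = (\<Sum>x\<in>UNIV-{0 :: 'a}. 1)"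
      using power_card_minus_1_field[where ?'a = 'a] unfolding card by (intro sum.cong) auto
    also have "\<dots> = of_nat CARD('a) - 1"
      using card_field_ge_3 by (simp add: card_Diff_singleton of_nat_diff)
    also have "of_nat CARD('a) = (0 :: 'a)"
      by (simp add: of_nat_eq_0_iff_char_dvd CHAR_dvd_CARD)
    finally show ?thesis
      using True by simp
  next
    case False
    have "\<not> 4 * k dvd 2 * j + 2 * k"
    proof
      assume "4 * k dvd 2 * j + 2 * k"
      then obtain c where c: "2 * j + 2 * k = 4 * k * c" ..
      have "c < 2"
      proof (rule ccontr)
        assume "\<not> c < 2"
        then have "4 * k * c \<ge> 4 * k * 2"
          by (intro mult_left_mono) auto
        with c that \<open>k > 0\<close> show False
          by simp
      qed
      then have "c = 0 \<or> c = 1"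
        by auto
      then show False
        using c False \<open>k > 0\<close> by auto
    qed
    then show ?thesis
      using False sum_power_eq_0[where ?'a = 'a] unfolding card by simp
  qed
  have "(of_int (cubic_sum (1 :: 'a)) :: 'a) = (\<Sum>x\<in>UNIV. (x ^ 3 - 1 * x) ^ (2 * k))"
    using card by (simp add: cubic_sum_def of_int_qchar)
  also have "\<dots> = (\<Sum>x\<in>UNIV. \<Sum>j\<le>2 * k. (of_nat (2 * k choose j) * (-1) ^ (2 * k - j)) * x ^ (2 * j + 2 * k))"
  proof (rule sum.cong)
    fix x :: 'a
    have "x ^ 3 - 1 * x = (x\<^sup>2 + (-1)) * x"
      by (simp add: algebra_simps power3_eq_cube power2_eq_square)
    then have "(x ^ 3 - 1 * x) ^ (2 * k) = (x\<^sup>2 + (-1)) ^ (2 * k) * x ^ (2 * k)"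
      by (simp only: power_mult_distrib)
    also have "\<dots> = (\<Sum>j\<le>2 * k. (of_nat (2 * k choose j) * (-1) ^ (2 * k - j)) * x ^ (2 * j + 2 * k))"
    proof -
      have "x ^ (2 * j + 2 * k) = (x\<^sup>2) ^ j * x ^ (2 * k)" for j
        by (simp add: power_add power_mult)
      then show ?thesis
        unfolding binomial_ring sum_distrib_right by (simp only: mult_ac)
    qed
    finally show "(x ^ 3 - 1 * x) ^ (2 * k) = \<dots>" .
  qed auto
  also have "\<dots> = (\<Sum>j\<le>2 * k. (of_nat (2 * k choose j) * (-1) ^ (2 * k - j)) * (\<Sum>x\<in>(UNIV :: 'a set). x ^ (2 * j + 2 * k)))"
    by (subst sum.swap) (simp add: sum_distrib_left)
  also have "\<dots> = (\<Sum>j\<in>{k}. - (of_nat (2 * k choose j) * (-1) ^ (2 * k - j)))"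
    using power_sum[of k] by (intro sum.mono_neutral_cong_right) (auto simp: power_sum)
  finally show ?thesis
    using card by (simp add: k_def[symmetric] mult_ac)
qed

end

section \<open>Prime powers as sums of two squares\<close>

text \<open>
  Otherwise raise \<open>a\<^sup>2 \<equiv> - b\<^sup>2\<close> to the odd power \<open>(p - 1)/2\<close>: by Fermat's little theorem
  this reads \<open>1 \<equiv> -1\<close>.
\<close>

lemma prime_3_mod_4_dvd_sum_squares:
  fixes a b :: int
  assumes p: "prime p" "[p = 3] (mod 4)" and dvd: "int p dvd a\<^sup>2 + b\<^sup>2"
  shows "int p dvd a \<and> int p dvd b"
proof (rule ccontr)
  assume contra: "\<not> ?thesis"
  define k where "k = (p - 1) div 2"
  have "p mod 4 = 3"
    using p(2) by (simp add: cong_def)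
  then have k: "p - 1 = 2 * k" "odd k"
    unfolding k_def by presburger+
  have cong: "[a\<^sup>2 = - (b\<^sup>2)] (mod int p)"
    using dvd by (simp add: cong_iff_dvd_diff)
  have a: "\<not> int p dvd a" and b: "\<not> int p dvd b"
    using contra dvd p(1)
    by (metis dvd_add_left_iff dvd_add_right_iff prime_dvd_power_int prime_nat_int_transfer power2_eq_square dvd_mult)+
  have fermat: "[c ^ (p - 1) = 1] (mod int p)" if c: "\<not> int p dvd c" for c
  proof -
    have "[nat \<bar>c\<bar> ^ (p - 1) = 1] (mod p)"
      using c p(1) by (intro fermat_theorem) (auto simp: int_dvd_int_iff[symmetric])
    then have "[\<bar>c\<bar> ^ (p - 1) = 1] (mod int p)"
      by (metis abs_ge_zero cong_int_iff nat_0_le of_nat_1 of_nat_power)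
    then show ?thesis
      unfolding k by (simp add: power_mult)
  qed
  have "[(a\<^sup>2) ^ k = (- (b\<^sup>2)) ^ k] (mod int p)"
    by (rule cong_pow) (rule cong)
  also have "(- (b\<^sup>2)) ^ k = - (b ^ (p - 1))"
    unfolding k(1) using k(2) by (simp add: power_minus_odd power_mult)
  also have "(a\<^sup>2) ^ k = a ^ (p - 1)"
    unfolding k by (simp add: power_mult)
  finally have "[a ^ (p - 1) = - (b ^ (p - 1))] (mod int p)" .
  with fermat[OF a] fermat[OF b] have "[1 = - 1] (mod int p)"
    by (meson cong_minus_minus_iff cong_sym cong_trans)
  then have "int p dvd 2"
    by (simp add: cong_iff_dvd_diff)
  then have "int p \<le> 2"
    by (rule zdvd_imp_le) simp
  with \<open>p mod 4 = 3\<close> show False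
    by (cases "p = 0"; cases "p = 1"; cases "p = 2") auto
qed

lemma sum_squares_prime_power_3_mod_4:
  fixes a b :: int
  assumes p: "prime p" "[p = 3] (mod 4)" and "int (p ^ r) = a\<^sup>2 + b\<^sup>2" "odd a"
  shows "even r \<and> \<bar>a\<bar> = int (p ^ (r div 2))"
  using assms(3,4)
proof (induction r arbitrary: a b rule: less_induct)
  case (less r)
  have "p > 0"
    using p(1) by (rule prime_gt_0_nat)
  consider "r = 0" | "r = 1" | r' where "r = Suc (Suc r')"
    by (metis One_nat_def not0_implies_Suc)
  then show ?case
  proof cases
    case 1
    have "a \<noteq> 0"
      using less.prems by auto
    then have "a\<^sup>2 > 0"
      by simp
    then have "a\<^sup>2 = 1"
      using less.prems(1) 1 zero_le_power2[of b] by (simp only: power_0 of_nat_1)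
    then show ?thesis
      using 1 by (auto simp: power2_eq_1_iff)
  next
    case 2
    then have "int p dvd a \<and> int p dvd b"
      using less.prems by (intro prime_3_mod_4_dvd_sum_squares p) (simp flip: less.prems)
    then have "(int p)\<^sup>2 dvd a\<^sup>2 + b\<^sup>2"
      by (auto intro: dvd_add dvd_power_same)
    then have "int p * int p dvd int p * 1"
      using 2 less.prems by (simp add: power2_eq_square)
    then have "int p dvd 1"
      using \<open>p > 0\<close> by (subst (asm) dvd_mult_cancel_left) auto
    then show ?thesis
      using prime_gt_1_nat[OF p(1)] by simp
  next
    case (3 r')
    have "int p dvd int (p ^ r)"
      by (simp add: 3)
    then have "int p dvd a \<and> int p dvd b"
      using less.prems(1) by (intro prime_3_mod_4_dvd_sum_squares p) simp
    then obtain a' b' where ab: "a = int p * a'" "b = int p * b'"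
      by (auto elim!: dvdE)
    have "(int p)\<^sup>2 * int (p ^ r') = (int p)\<^sup>2 * (a'\<^sup>2 + b'\<^sup>2)"
      using less.prems(1) by (simp add: 3 ab algebra_simps power2_eq_square)
    then have "int (p ^ r') = a'\<^sup>2 + b'\<^sup>2"
      using \<open>p > 0\<close> by simp
    moreover have "odd a'"
      using less.prems(2) ab by simp
    ultimately have "even r' \<and> \<bar>a'\<bar> = int (p ^ (r' div 2))"
      using 3 by (intro less.IH) auto
    then show ?thesis
      by (auto simp: 3 ab abs_mult)
  qed
qed

text \<open>
  The product \<open>(s u - t v) (s u + t v)\<close> is divisible by \<open>q\<close>, and \<open>p\<close> cannot divide both factors
  because their sum is \<open>2 s u\<close>. So \<open>q\<close> divides one of them, and the identity
  \<open>q\<^sup>2 = (s u - t v)\<^sup>2 + (s v + t u)\<^sup>2\<close> forces one of its two terms to vanish. If it is the first,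
  then \<open>q = s\<^sup>2 + u\<^sup>2\<close> would be even; if it is the second, then \<open>s\<^sup>2 = u\<^sup>2\<close>.
\<close>

lemma sum_two_squares_prime_power_unique:
  fixes s t u v :: int
  assumes p: "prime p" "odd p" and "q = p ^ r"
    and st: "int q = s\<^sup>2 + t\<^sup>2" and uv: "int q = u\<^sup>2 + v\<^sup>2"
    and s: "\<not> int p dvd s" "odd s" and u: "\<not> int p dvd u" "odd u"
  shows "s\<^sup>2 = u\<^sup>2"
proof -
  have "int q > 0"
    using prime_gt_0_nat[OF p(1)] by (simp add: assms(3))
  have key: "s\<^sup>2 = u\<^sup>2" if dvd: "int q dvd s * u - t * v" and uv: "int q = u\<^sup>2 + v\<^sup>2" for v
  proof -
    from dvd obtain c where c: "s * u - t * v = int q * c" ..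
    have "(int q)\<^sup>2 = (s * u - t * v)\<^sup>2 + (s * v + t * u)\<^sup>2"
      unfolding power2_eq_square[of "int q"]
      by (subst (1) st, subst uv) (simp add: power2_eq_square algebra_simps)
    then have sum: "(int q)\<^sup>2 = (int q)\<^sup>2 * c\<^sup>2 + (s * v + t * u)\<^sup>2"
      by (simp add: c power_mult_distrib)
    show ?thesis
    proof (cases "c = 0")
      case True
      then have "(s * u)\<^sup>2 = (t * v)\<^sup>2"
        using c by simp
      also have "\<dots> = (int q - s\<^sup>2) * (int q - u\<^sup>2)"
        using st uv by (simp add: power_mult_distrib)
      finally have "int q * (int q - s\<^sup>2 - u\<^sup>2) = 0"
        by (simp add: algebra_simps power_mult_distrib power2_eq_square)
      then have "int q = s\<^sup>2 + u\<^sup>2"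
        using \<open>int q > 0\<close> by simp
      then have "even (int q)"
        using s u by simp
      then show ?thesis
        using p by (simp add: assms(3))
    next
      case False
      then have "c\<^sup>2 \<ge> 1"
        by (metis int_one_le_iff_zero_less zero_less_power2)
      then have "(int q)\<^sup>2 * c\<^sup>2 \<ge> (int q)\<^sup>2 * 1"
        by (intro mult_left_mono) auto
      then have "(s * v + t * u)\<^sup>2 \<le> 0"
        using sum by linarith
      then have "s * v = - (t * u)"
        by (simp add: eq_neg_iff_add_eq_0)
      then have "s\<^sup>2 * v\<^sup>2 = t\<^sup>2 * u\<^sup>2"
        by (metis power2_minus power_mult_distrib)
      moreover have "v\<^sup>2 = int q - u\<^sup>2" "t\<^sup>2 = int q - s\<^sup>2"
        using st uv by simp_all
      ultimately have "int q * s\<^sup>2 = int q * u\<^sup>2"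
        by (simp add: algebra_simps)
      then show ?thesis
        using \<open>int q > 0\<close> by simp
    qed
  qed
  have "(s * u - t * v) * (s * u + t * v) = (s * u)\<^sup>2 - t\<^sup>2 * v\<^sup>2"
    by (simp add: power2_eq_square algebra_simps)
  also have "\<dots> = int q * (s\<^sup>2 + u\<^sup>2 - int q)"
  proof -
    have v: "v\<^sup>2 = int q - u\<^sup>2" and t: "t\<^sup>2 = int q - s\<^sup>2"
      using st uv by simp_all
    show ?thesis
      unfolding v t power_mult_distrib by (simp add: algebra_simps)
  qed
  finally have dvd: "int p ^ r dvd (s * u - t * v) * (s * u + t * v)"
    by (simp add: assms(3))
  have prime: "prime (int p)"
    using p(1) by simp
  have "\<not> int p dvd 2"
  proof
    assume "int p dvd 2"
    then have "p dvd 2"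
      by (metis int_dvd_int_iff of_nat_numeral)
    then show False
      using p primes_dvd_imp_eq[OF p(1) two_is_prime_nat] by simp
  qed
  then have "\<not> int p dvd 2 * (s * u)"
    using s u prime by (simp add: prime_dvd_mult_iff)
  then have "\<not> (int p dvd s * u - t * v \<and> int p dvd s * u + t * v)"
    using dvd_add[of "int p" "s * u - t * v" "s * u + t * v"] by (auto simp: algebra_simps)
  then consider "coprime (int p ^ r) (s * u - t * v)" | "coprime (int p ^ r) (s * u + t * v)"
    using prime_imp_coprime[OF prime, of "s * u - t * v"] prime_imp_coprime[OF prime, of "s * u + t * v"]
    unfolding coprime_power_left_iff by blast
  then consider "int p ^ r dvd s * u + t * v" | "int p ^ r dvd s * u - t * v"
    using dvd by cases (simp_all add: coprime_dvd_mult_left_iff coprime_dvd_mult_right_iff)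
  then show ?thesis
  proof cases
    case 1
    then show ?thesis
      using key[of "-v"] uv by (simp add: assms(3))
  next
    case 2
    then show ?thesis
      using key[of v] uv by (simp add: assms(3))
  qed
qed

section \<open>A binomial coefficient prime to p\<close>

lemma multiplicity_fact_digit:
  assumes p: "prime p" and "b < p"
  shows "multiplicity p (fact (p * a + b) :: nat) = a + multiplicity p (fact a :: nat)"
proof -
  have "p > 0"
    using p by (rule prime_gt_0_nat)
  have digit: "multiplicity p (fact (p * a + b) :: nat) = multiplicity p (fact (p * a) :: nat)"
    if "b < p" for a b
    using that
  proof (induction b)
    case (Suc b)
    have "\<not> p dvd p * a + Suc b"
    proof
      assume "p dvd p * a + Suc b"
      then have "p dvd Suc b"
        by (subst (asm) dvd_add_right_iff) auto
      then show False
        using Suc.prems by (auto dest: dvd_imp_le)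
    qed
    moreover have "(fact (p * a + Suc b) :: nat) = (p * a + Suc b) * fact (p * a + b)"
      by simp
    ultimately show ?case
      using Suc p
      by (simp only:) (simp add: prime_elem_multiplicity_mult_distrib not_dvd_imp_multiplicity_0 del: mult_Suc)
  qed simp
  have "multiplicity p (fact (p * a) :: nat) = a + multiplicity p (fact a :: nat)"
  proof (induction a)
    case (Suc a)
    have "(fact (p * Suc a) :: nat) = p * (Suc a * fact (p * a + (p - 1)))"
      using \<open>p > 0\<close> by (cases p) (simp_all add: algebra_simps)
    then have "multiplicity p (fact (p * Suc a) :: nat) =
        Suc (multiplicity p (Suc a) + multiplicity p (fact (p * a + (p - 1)) :: nat))"
      using p \<open>p > 0\<close> by (simp only:) (simp add: prime_elem_multiplicity_mult_distrib del: mult_Suc)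
    then show ?case
      using p Suc digit[of "p - 1" a] \<open>p > 0\<close>
      by (simp add: prime_elem_multiplicity_mult_distrib del: mult_Suc)
  qed simp
  then show ?thesis
    using digit[OF \<open>b < p\<close>] by simp
qed

lemma multiplicity_choose_fact:
  assumes p: "prime p" and "k \<le> n"
  shows "multiplicity p (n choose k) + multiplicity p (fact k :: nat) + multiplicity p (fact (n - k) :: nat)
    = multiplicity p (fact n :: nat)"
proof -
  have "(fact n :: nat) = (n choose k) * (fact k * fact (n - k))"
    using binomial_fact_lemma[OF \<open>k \<le> n\<close>] by (simp add: mult_ac)
  then show ?thesis
    using p \<open>k \<le> n\<close> by (simp only:) (simp add: prime_elem_multiplicity_mult_distrib)
qed

text \<open>
  The case of Lucas' theorem in which subtracting the last digit needs no borrow, on the level of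
  multiplicities. Only this is needed to strip the base \<open>p\<close> digits one by one.
\<close>

lemma multiplicity_choose_digit:
  assumes p: "prime p" and "c \<le> a" "d \<le> b" "b < p"
  shows "multiplicity p ((p * a + b) choose (p * c + d)) = multiplicity p (a choose c)"
proof -
  have "multiplicity p (fact (p * a + b - (p * c + d)) :: nat) = (a - c) + multiplicity p (fact (a - c) :: nat)"
  proof -
    have "p * c \<le> p * a"
      using assms by simp
    then have "p * a + b - (p * c + d) = p * (a - c) + (b - d)"
      using assms by (simp add: diff_mult_distrib2)
    then show ?thesis
      using assms by (simp only: multiplicity_fact_digit less_imp_diff_less)
  qed
  moreover have "p * c + d \<le> p * a + b"
    using assms by (intro add_mono mult_left_mono) auto
  ultimately show ?thesis
    using multiplicity_choose_fact[OF p, of "p * c + d" "p * a + b"] 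
      multiplicity_choose_fact[OF p \<open>c \<le> a\<close>] assms
    by (simp add: multiplicity_fact_digit)
qed

text \<open>
  With \<open>p = 4 h + 1\<close>, all base \<open>p\<close> digits of \<open>(p ^ r - 1) div 2\<close> are \<open>2 h\<close> and all those of
  \<open>(p ^ r - 1) div 4\<close> are \<open>h\<close>.
\<close>

lemma prime_not_dvd_central_choose:
  assumes p: "prime p" "[p = 1] (mod 4)"
  shows "\<not> p dvd (((p ^ r - 1) div 2) choose ((p ^ r - 1) div 4))"
proof -
  obtain h where h: "p = 4 * h + 1"
  proof
    show "p = 4 * (p div 4) + 1"
      using p(2) unfolding cong_def by presburger
  qed
  have "4 dvd p ^ r - 1 \<and> multiplicity p (((p ^ r - 1) div 2) choose ((p ^ r - 1) div 4)) = 0"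
  proof (induction r)
    case (Suc r)
    obtain k where k: "p ^ r - 1 = 4 * k"
      using Suc by auto
    have "p ^ r > 0"
      using h by simp
    with k have "p ^ r = 4 * k + 1"
      by linarith
    then have *: "p ^ Suc r - 1 = 4 * (p * k + h)"
      by (simp add: h algebra_simps)
    have "multiplicity p ((p * (2 * k) + 2 * h) choose (p * k + h)) = multiplicity p (2 * k choose k)"
      using p h by (intro multiplicity_choose_digit) auto
    moreover have "(p ^ Suc r - 1) div 2 = p * (2 * k) + 2 * h" "(p ^ Suc r - 1) div 4 = p * k + h"
      unfolding * by (simp_all add: algebra_simps)
    moreover have "(p ^ r - 1) div 2 = 2 * k" "(p ^ r - 1) div 4 = k"
      unfolding k by simp_all
    ultimately show ?case
      using Suc.IH * by (simp only: dvd_triv_left simp_thms)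
  qed auto
  moreover have "((p ^ r - 1) div 2) choose ((p ^ r - 1) div 4) \<noteq> 0"
    by (simp add: div_le_mono2)
  ultimately show ?thesis
    using p prime_gt_1_nat[OF p(1)] by (simp add: multiplicity_eq_zero_iff)
qed

section \<open>The number of non-square triples\<close>

text \<open>
  The count itself shows that the cubic sum is even, as \<open>q - 3\<close> is; then the second square is even, too.
\<close>

lemma half_cubic_sum_two_squares:
  assumes q: "CARD('a :: {field, finite}) mod 4 = 1"
  obtains A B where "cubic_sum (1 :: 'a) = 2 * A" "int CARD('a) = A\<^sup>2 + B\<^sup>2"
    "8 * int (num_nonsquare_triples TYPE('a)) = int CARD('a) - 3 - 2 * A"
proof -
  have odd: "odd CARD('a)"
    using q by presburger
  have "even ((CARD('a) - 1) div 2)"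
    using q by presburger
  then have minus_1: "qchar (-1 :: 'a) = 1"
    by (simp add: qchar_minus_1[OF odd])
  have N: "8 * int (num_nonsquare_triples TYPE('a)) = int CARD('a) - 3 - cubic_sum (1 :: 'a)"
    using num_nonsquare_triples_char_sum[OF odd] by (simp add: minus_1)
  then have "even (cubic_sum (1 :: 'a))"
    using odd by presburger
  then obtain A where A: "cubic_sum (1 :: 'a) = 2 * A"
    by (rule evenE)
  obtain n :: 'a where "qchar n = -1"
    using ex_nonsquare[OF odd] by blast
  then have squares: "(cubic_sum (1 :: 'a))\<^sup>2 + (cubic_sum n)\<^sup>2 = 4 * int CARD('a)"
    by (rule sum_two_squares_cubic_sums[OF odd minus_1])
  then have "(cubic_sum n)\<^sup>2 = 2 * (2 * int CARD('a) - 2 * A\<^sup>2)"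
    by (simp add: A power_mult_distrib)
  then have "even ((cubic_sum n)\<^sup>2)"
    by simp
  then have "even (cubic_sum n)"
    by simp
  then obtain B where B: "cubic_sum n = 2 * B"
    by (rule evenE)
  show ?thesis
    using that[of A B] squares N by (simp add: A B power_mult_distrib)
qed

lemma normalized_square_part_unique:
  assumes p: "prime p" "odd p" and q: "q = p ^ r"
    and s: "normalized_square_part p q s" and u: "normalized_square_part p q u"
  shows "s = u"
proof -
  obtain t v where tv: "int q = s\<^sup>2 + t\<^sup>2" "int q = u\<^sup>2 + v\<^sup>2"
    using s u by (auto simp: normalized_square_part_def)
  have mod4: "s mod 4 = 1" "u mod 4 = 1"
    using s u by (auto simp: normalized_square_part_def cong_def)
  then have odd: "odd s" "odd u"
    by presburger+
  have "s\<^sup>2 = u\<^sup>2"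
    using s u odd by (intro sum_two_squares_prime_power_unique[OF p q tv])
      (auto simp: normalized_square_part_def)
  then have "s = u \<or> s = - u"
    by (simp add: power2_eq_iff)
  then show ?thesis
    using mod4 by presburger
qed

lemma not_dvd_cubic_sum:
  assumes p: "prime p" "[p = 1] (mod 4)" and q: "CARD('a :: {field, finite}) = p ^ r"
  shows "\<not> int p dvd cubic_sum (1 :: 'a)"
proof
  assume dvd: "int p dvd cubic_sum (1 :: 'a)"
  have "p mod 4 = 1"
    using p(2) by (simp add: cong_def)
  then have "odd p"
    by presburger
  then have odd: "odd CARD('a)"
    by (simp add: q)
  have "[p ^ r = 1 ^ r] (mod 4)"
    by (rule cong_pow) (rule p)
  then have "4 dvd CARD('a) - 1"
    unfolding q cong_def by simp presburger
  note of_int = of_int_cubic_sum[OF odd this]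
  have "prime CHAR('a)"
    by (intro prime_CHAR_semidom finite_imp_CHAR_pos) auto
  moreover have "CHAR('a) dvd p ^ r"
    using CHAR_dvd_CARD[where ?'a = 'a] by (simp add: q)
  ultimately have char: "CHAR('a) = p"
    using p(1) by (metis prime_dvd_power primes_dvd_imp_eq)
  have "of_int (cubic_sum (1 :: 'a)) = (0 :: 'a)"
    using dvd by (simp add: of_int_eq_0_iff_char_dvd char)
  then have "p dvd (((p ^ r - 1) div 2) choose ((p ^ r - 1) div 4))"
    unfolding of_int by (simp add: of_nat_eq_0_iff_char_dvd char q)
  then show False
    using prime_not_dvd_central_choose[OF p] by simp
qed

theorem mainTheorem7:
  fixes p r q N :: nat
  assumes "prime p" and "odd p" and "r \<ge> 1" and "q = p ^ r"
    and "CARD('a :: {field, finite}) = q"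
    and "N = num_nonsquare_triples TYPE('a)"
  shows
    "([q = 7] (mod 8) \<longrightarrow> real N = (real q - 7) / 8) \<and>
     ([q = 3] (mod 8) \<longrightarrow> real N = (real q - 3) / 8) \<and>
     ([q = 5] (mod 8) \<longrightarrow>
        (\<exists>!s. normalized_square_part p q s) \<and>
        (\<forall>s. normalized_square_part p q s \<longrightarrow>
             real N = (real q - 2 * real_of_int s - 3) / 8)) \<and>
     ([q = 1] (mod 8) \<and> [p = 1] (mod 4) \<longrightarrow>
        (\<exists>!s. normalized_square_part p q s) \<and>
        (\<forall>s. normalized_square_part p q s \<longrightarrow>
             real N = (real q + 2 * real_of_int s - 3) / 8)) \<and>
     ([q = 1] (mod 8) \<and> [p = 3] (mod 4) \<longrightarrow>
        is_square q \<and> even r \<and>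
        real N = 1 / 8 * (real q + 2 * (-1) ^ (r div 2) * sqrt (real q) - 3))"
proof -
  have odd_q: "odd CARD('a)"
    using assms by simp
  have "(-2 :: 'a) \<noteq> 0"
    using two_neq_0[OF odd_q] by simp
  then have minus_2: "qchar (-2 :: 'a) = 1 \<or> qchar (-2 :: 'a) = -1"
    using qchar_cases[of "-2 :: 'a"] by auto
  have three_mod_4: "8 * int N = int q - 3 - 2 * (1 - qchar (-2 :: 'a))" if "q mod 4 = 3"
  proof -
    have "odd ((CARD('a) - 1) div 2)"
      using that assms(5) by presburger
    then have minus_1: "qchar (-1 :: 'a) = -1"
      by (simp add: qchar_minus_1[OF odd_q])
    show ?thesis
      using num_nonsquare_triples_char_sum[OF odd_q] assms(5,6)
      by (simp add: minus_1 cubic_sum_eq_0[OF odd_q minus_1])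
  qed
  have one_mod_4: "\<exists>A B. cubic_sum (1 :: 'a) = 2 * A \<and> int q = A\<^sup>2 + B\<^sup>2 \<and> 8 * int N = int q - 3 - 2 * A"
    if "q mod 4 = 1"
    using half_cubic_sum_two_squares[where ?'a = 'a] that assms(5,6) by metis
  \<comment> \<open>Reducing \<open>2 A = q - 3 - 8 N\<close> modulo \<open>8\<close> determines \<open>A\<close> modulo \<open>4\<close>.\<close>
  have A_mod_5: "A mod 4 = 1" if N: "8 * int N = int q - 3 - 2 * A" and q: "q mod 8 = 5" for A
  proof -
    obtain k :: int where "int q = 8 * k + 5"
      using mult_div_mod_eq[of 8 q] q by (metis of_nat_add of_nat_mult of_nat_numeral)
    then have "A = 4 * (k - int N) + 1"
      using N by presburger
    then show ?thesis
      by presburger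
  qed
  have A_mod_1: "A mod 4 = 3" if N: "8 * int N = int q - 3 - 2 * A" and q: "q mod 8 = 1" for A
  proof -
    obtain k :: int where "int q = 8 * k + 1"
      using mult_div_mod_eq[of 8 q] q by (metis of_nat_add of_nat_mult of_nat_numeral of_nat_1)
    then have "A = 4 * (k - int N - 1) + 3"
      using N by presburger
    then show ?thesis
      by presburger
  qed
  have split_case: "(\<exists>!s. normalized_square_part p q s) \<and>
      (\<forall>s. normalized_square_part p q s \<longrightarrow> real N = (real q + 2 * c * real_of_int s - 3) / 8)"
    if p1: "p mod 4 = 1" and q1: "q mod 4 = 1"
      and c: "(c :: real) = (if q mod 8 = 5 then - 1 else 1)" for c
  proof -
    obtain A B where A: "cubic_sum (1 :: 'a) = 2 * A" and AB: "int q = A\<^sup>2 + B\<^sup>2"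
      and N: "8 * int N = int q - 3 - 2 * A"
      using one_mod_4[OF q1] by blast
    define s where "s = (if q mod 8 = 5 then A else - A)"
    have "s mod 4 = 1"
    proof (cases "q mod 8 = 5")
      case True
      then show ?thesis
        using A_mod_5[OF N] by (simp add: s_def)
    next
      case False
      with q1 have "A mod 4 = 3"
        by (intro A_mod_1[OF N]) presburger
      then have "- A mod 4 = 1"
        by presburger
      with False show ?thesis
        by (simp add: s_def)
    qed
    moreover have "\<not> int p dvd A"
      using not_dvd_cubic_sum[where ?'a = 'a, of p r] assms p1 by (auto simp: A cong_def)
    ultimately have s: "normalized_square_part p q s"
      using AB by (auto simp: normalized_square_part_def s_def cong_def)
    have "8 * real N = real_of_int (8 * int N)"
      by simp
    also have "\<dots> = real q + 2 * c * real_of_int s - 3"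
      unfolding N c s_def by simp
    finally have "real N = (real q + 2 * c * real_of_int s - 3) / 8"
      by simp
    moreover have "u = s" if "normalized_square_part p q u" for u
      using normalized_square_part_unique[OF assms(1,2,4) that s] .
    ultimately show ?thesis
      using s by blast
  qed
  have inert_case: "is_square q \<and> even r \<and>
      real N = 1 / 8 * (real q + 2 * (-1) ^ (r div 2) * sqrt (real q) - 3)"
    if p: "p mod 4 = 3" and q: "q mod 8 = 1"
  proof -
    have "q mod 4 = 1"
      using q by presburger
    then obtain A B where AB: "int q = A\<^sup>2 + B\<^sup>2" and N: "8 * int N = int q - 3 - 2 * A"
      using one_mod_4 by blast
    have A_mod: "A mod 4 = 3"
      using A_mod_1[OF N q] .
    then have "odd A"
      by presburger
    then have r: "even r" and abs_A: "\<bar>A\<bar> = int (p ^ (r div 2))"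
      using sum_squares_prime_power_3_mod_4[OF assms(1), of r A B] p AB assms(4)
      by (auto simp: cong_def)
    have q_square: "q = (p ^ (r div 2))\<^sup>2"
      using r by (simp add: assms(4) flip: power_mult)
    then have sqrt_q: "sqrt (real q) = real (p ^ (r div 2))"
      by simp
    have "[int p = - 1] (mod 4)"
      using p unfolding cong_def by presburger
    then have "[int p ^ (r div 2) = (- 1) ^ (r div 2)] (mod 4)"
      by (rule cong_pow)
    \<comment> \<open>The residue of \<open>A\<close> modulo \<open>4\<close> fixes its sign.\<close>
    then have cong: "\<bar>A\<bar> mod 4 = (- 1) ^ (r div 2) mod 4"
      by (simp add: abs_A cong_def)
    have "A = - ((- 1) ^ (r div 2) * \<bar>A\<bar>)"
    proof (cases "even (r div 2)")
      case True
      then have "\<bar>A\<bar> mod 4 = 1"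
        using cong by simp
      with A_mod have "A < 0"
        by (cases "A < 0") auto
      with True show ?thesis
        by simp
    next
      case False
      then have "\<bar>A\<bar> mod 4 = 3"
        using cong by simp
      with A_mod have "A \<ge> 0"
        by (cases "A < 0") presburger+
      with False show ?thesis
        by simp
    qed
    then have "8 * int N = int q - 3 + 2 * ((- 1) ^ (r div 2) * int (p ^ (r div 2)))"
      using N unfolding abs_A by simp
    then have "real_of_int (8 * int N) = real_of_int (int q - 3 + 2 * ((- 1) ^ (r div 2) * int (p ^ (r div 2))))"
      by (rule arg_cong)
    then have "8 * real N = real q - 3 + 2 * (- 1) ^ (r div 2) * sqrt (real q)"
      by (simp add: sqrt_q)
    then show ?thesis
      using r q_square by (auto intro: is_nth_powerI)
  qed
  \<comment> \<open>For \<open>p \<equiv> 3 (mod 4)\<close>, the exponent would be even and \<open>q\<close> an odd square.\<close>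
  have p_mod: "p mod 4 = 1" if "q mod 8 = 5"
  proof (rule ccontr)
    assume "p mod 4 \<noteq> 1"
    with \<open>odd p\<close> have "[int p = - 1] (mod 4)"
      unfolding cong_def by presburger
    then have "[int p ^ r = (- 1) ^ r] (mod 4)"
      by (rule cong_pow)
    then have cong: "int q mod 4 = (- 1) ^ r mod 4"
      by (simp add: assms(4) cong_def)
    have "int q mod 4 = 1"
      using that by presburger
    then have "even r"
      using cong by (cases "even r") auto
    then have "q = (p ^ (r div 2))\<^sup>2"
      by (simp add: assms(4) flip: power_mult)
    moreover have "odd (p ^ (r div 2))"
      using \<open>odd p\<close> by simp
    ultimately have "q mod 8 = 1"
      using square_mod_8_eq_1_iff[of "p ^ (r div 2)"] by (simp add: cong_def)
    with that show False
      by simp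
  qed
  have real_N: "real N = real_of_int c / 8" if "8 * int N = c" for c
  proof -
    have "8 * real N = real_of_int (8 * int N)"
      by simp
    then show ?thesis
      using that by simp
  qed
  have mod_4: "q mod 4 = q mod 8 mod 4"
    by (simp add: mod_mod_cancel)
  have int_mod_8: "int q mod 8 = int (q mod 8)"
    by (simp add: zmod_int)
  show ?thesis
  proof (intro conjI impI)
    assume "[q = 7] (mod 8)"
    then have q: "q mod 8 = 7"
      by (simp add: cong_def)
    then have "q mod 4 = 3" and int_q: "int q mod 8 = 7"
      by (simp_all add: mod_4 int_mod_8)
    then have vals: "8 * int N = int q - 3 \<or> 8 * int N = int q - 7"
      using three_mod_4 minus_2 by auto
    \<comment> \<open>The choice \<open>\<chi>(-2) = 1\<close> would make \<open>q - 3\<close> divisible by \<open>8\<close>.\<close>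
    then have "8 * int N = int q - 7"
      using vals int_q by presburger
    then show "real N = (real q - 7) / 8"
      using real_N by simp
  next
    assume "[q = 3] (mod 8)"
    then have q: "q mod 8 = 3"
      by (simp add: cong_def)
    then have "q mod 4 = 3" and int_q: "int q mod 8 = 3"
      by (simp_all add: mod_4 int_mod_8)
    then have vals: "8 * int N = int q - 3 \<or> 8 * int N = int q - 7"
      using three_mod_4 minus_2 by auto
    then have "8 * int N = int q - 3"
      using vals int_q by presburger
    then show "real N = (real q - 3) / 8"
      using real_N by simp
  next
    assume "[q = 5] (mod 8)"
    then have q: "q mod 8 = 5" "q mod 4 = 1"
      by (simp_all add: cong_def mod_4)
    note split_case[OF p_mod[OF q(1)] q(2), of "-1"]
    with q(1) show "\<exists>!s. normalized_square_part p q s"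
      "\<forall>s. normalized_square_part p q s \<longrightarrow> real N = (real q - 2 * real_of_int s - 3) / 8"
      by simp_all
  next
    assume "[q = 1] (mod 8) \<and> [p = 1] (mod 4)"
    then have q: "q mod 8 = 1" "q mod 4 = 1" "p mod 4 = 1"
      by (simp_all add: cong_def mod_4)
    note split_case[OF q(3,2), of 1]
    with q(1) show "\<exists>!s. normalized_square_part p q s"
      "\<forall>s. normalized_square_part p q s \<longrightarrow> real N = (real q + 2 * real_of_int s - 3) / 8"
      by simp_all
  next
    assume "[q = 1] (mod 8) \<and> [p = 3] (mod 4)"
    then have "p mod 4 = 3" "q mod 8 = 1"
      by (auto simp: cong_def)
    note inert_case[OF this]
    then show "is_square q" "even r"
      "real N = 1 / 8 * (real q + 2 * (-1) ^ (r div 2) * sqrt (real q) - 3)"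
      by blast+
  qed
qed

end
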